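(* Let $\mathsf{S}_\alpha$ be a horizontal strip, let $T$ be a densely defined operator on a complex Hilbert space $\mathcal{H}$ with numerical range $\mathfrak{n}_T\subseteq\mathsf{S}_\alpha$, and let $T=S+iB$ be its decomposition with $S$ and $B\in\mathcal{B}(\mathcal{H})$ the unique symmetric operators such that $D(S)=D(T)$ and $T=S+iB$. Then the map $S'\mapsto T':=S'+iB$ defines 1. a one-to-one correspondence between all extensions $S'$ of $S$ and all extensions $T'$ of $T$; 2. a one-to-one correspondence between all symmetric extensions $S'$ of $S$ and all extensions $T'$ of $T$ with numerical range $\mathfrak{n}_{T'}\subseteq\overline{\mathsf{S}_\alpha}$.
   Context: $\mathcal{H}$ is a complex Hilbert space with inner product $\langle\cdot|\cdot\rangle$ and norm $\|\cdot\|$. An operator $T$ on $\mathcal{H}$ is a linear map from a linear subspace $D(T)\subseteq\mathcal{H}$ to $\mathcal{H}$. $\mathcal{B}(\mathcal{H})$ is the set of bounded operators defined on the whole of $\mathcal{H}$. An extension of $T$ is an operator $T'$ on $\mathcal{H}$ with $D(T)\subseteq D(T')$ that agrees with $T$ on $D(T)$. The numerical range of $T$ is $\mathfrak{n}_T:=\{\langle T\xi|\xi\rangle:\xi\in D(T),\|\xi\|=1\}$. An operator $T$ is symmetric if it is densely defined and $\mathfrak{n}_T\subseteq\mathbb{R}$. For $\alpha\ge0$, a horizontal strip $\mathsf{S}_\alpha$ is a subset of $\mathbb{C}$ with $\{\lambda\in\mathbb{C}:|\Im\lambda|<\alpha\}\subseteq\mathsf{S}_\alpha\subseteq\{\lambda\in\mathbb{C}:|\Im\lambda|\le\alpha\}$,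 and $\overline{\mathsf{S}_\alpha}:=\{\lambda\in\mathbb{C}:|\Im\lambda|\le\alpha\}$. For every densely defined $T$ with $\mathfrak{n}_T\subseteq\mathsf{S}_\alpha$, symmetric operators $S$ and $B\in\mathcal{B}(\mathcal{H})$ with $D(S)=D(T)$ and $T=S+iB$ exist and are unique. *)

theory Defs
  imports "HOL-Analysis.Analysis"
begin

class complex_vector = real_vector +
  fixes scaleC :: "complex \<Rightarrow> 'a \<Rightarrow> 'a" (infixr "*\<^sub>C" 75)
  assumes scaleC_add_right: "a *\<^sub>C (x + y) = a *\<^sub>C x + a *\<^sub>C y"
    and scaleC_add_left: "(a + b) *\<^sub>C x = a *\<^sub>C x + b *\<^sub>C x"
    and scaleC_scaleC: "a *\<^sub>C (b *\<^sub>C x) = (a * b) *\<^sub>C x"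
    and scaleC_of_real: "complex_of_real r *\<^sub>C x = r *\<^sub>R x"

global_interpretation complex_vector: vector_space "scaleC :: complex \<Rightarrow> 'a \<Rightarrow> 'a::complex_vector"
  defines csubspace = complex_vector.subspace
proof
  show "1 *\<^sub>C x = x" for x :: 'a
    using scaleC_of_real[of 1 x] by simp
qed (simp_all add: scaleC_add_right scaleC_add_left scaleC_scaleC)

(* The inner product is linear in the first argument. The norm axioms inherited from
   real_normed_vector are redundant given norm_eq_sqrt_cinner; they are kept so that the
   topology and completeness are the library's. *)
class complex_inner = complex_vector + real_normed_vector +
  fixes cinner :: "'a \<Rightarrow> 'a \<Rightarrow> complex"
  assumes cinner_commute: "cinner x y = cnj (cinner y x)"
    and cinner_add_left: "cinner (x + y) z = cinner x z + cinner y z"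
    and cinner_scaleC_left: "cinner (a *\<^sub>C x) y = a * cinner x y"
    and cinner_ge_zero: "0 \<le> Re (cinner x x)"
    and cinner_eq_zero_iff: "cinner x x = 0 \<longleftrightarrow> x = 0"
    and norm_eq_sqrt_cinner: "norm x = sqrt (Re (cinner x x))"

class chilbert_space = complex_inner + complete_space

instantiation complex :: chilbert_space
begin

definition scaleC_complex :: "complex \<Rightarrow> complex \<Rightarrow> complex"
  where "scaleC_complex a x = a * x"

definition cinner_complex :: "complex \<Rightarrow> complex \<Rightarrow> complex"
  where "cinner_complex x y = x * cnj y"

instance
  by standard
    (auto simp: scaleC_complex_def cinner_complex_def algebra_simps scaleR_conv_of_real
      cmod_def power2_eq_square)

end

(* An operator is a partial function whose domain D(T) is dom T, so that equality of
   operators includes equality of domains, and "T' extends T" is the library's map_le. *)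
definition operator :: "('a::complex_vector \<rightharpoonup> 'a) \<Rightarrow> bool"
  where "operator T \<longleftrightarrow> csubspace (dom T) \<and>
    (\<forall>x\<in>dom T. \<forall>y\<in>dom T. the (T (x + y)) = the (T x) + the (T y)) \<and>
    (\<forall>c. \<forall>x\<in>dom T. the (T (c *\<^sub>C x)) = c *\<^sub>C the (T x))"

definition extensions :: "('a::complex_vector \<rightharpoonup> 'a) \<Rightarrow> ('a \<rightharpoonup> 'a) set"
  where "extensions T = {T'. operator T' \<and> T \<subseteq>\<^sub>m T'}"

definition densely_defined :: "('a::chilbert_space \<rightharpoonup> 'a) \<Rightarrow> bool"
  where "densely_defined T \<longleftrightarrow> closure (dom T) = UNIV"

definition bounded_operator :: "('a::chilbert_space \<rightharpoonup> 'a) \<Rightarrow> bool"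
  where "bounded_operator B \<longleftrightarrow> operator B \<and> dom B = UNIV \<and>
    (\<exists>K. \<forall>x. norm (the (B x)) \<le> K * norm x)"

definition numerical_range :: "('a::chilbert_space \<rightharpoonup> 'a) \<Rightarrow> complex set"
  where "numerical_range T = {cinner (the (T x)) x | x. x \<in> dom T \<and> norm x = 1}"

definition symmetric_operator :: "('a::chilbert_space \<rightharpoonup> 'a) \<Rightarrow> bool"
  where "symmetric_operator T \<longleftrightarrow>
    operator T \<and> densely_defined T \<and> numerical_range T \<subseteq> \<real>"

definition op_add :: "('a \<rightharpoonup> 'a) \<Rightarrow> ('a \<rightharpoonup> 'a) \<Rightarrow> ('a::complex_vector \<rightharpoonup> 'a)" (infixl "+\<^sub>o" 65)
  where "S +\<^sub>o T = (\<lambda>x. if x \<in> dom S \<inter> dom T then Some (the (S x) + the (T x)) else None)"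

definition op_scale :: "complex \<Rightarrow> ('a \<rightharpoonup> 'a) \<Rightarrow> ('a::complex_vector \<rightharpoonup> 'a)" (infixr "*\<^sub>o" 75)
  where "c *\<^sub>o T = (\<lambda>x. map_option (\<lambda>y. c *\<^sub>C y) (T x))"

definition closed_strip :: "real \<Rightarrow> complex set"
  where "closed_strip \<alpha> = {z. \<bar>Im z\<bar> \<le> \<alpha>}"

(* A horizontal strip may contain an arbitrary part of the two boundary lines. *)
definition horizontal_strip :: "real \<Rightarrow> complex set \<Rightarrow> bool"
  where "horizontal_strip \<alpha> A \<longleftrightarrow> 0 \<le> \<alpha> \<and> {z. \<bar>Im z\<bar> < \<alpha>} \<subseteq> A \<and> A \<subseteq> closed_strip \<alpha>"

end

theory Submission
  imports Defs
begin

text \<open>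
  Since \<open>B\<close> is defined everywhere, adding \<open>\<i>B\<close> is undone by adding \<open>-\<i>B\<close>; both
  operations preserve linearity, domains and inclusion of graphs. This gives the correspondence
  between all extensions.

  For the second correspondence it then suffices to show, for a single extension \<open>S'\<close> of
  \<open>S\<close>, that \<open>S'\<close> is symmetric iff \<open>T' = S' + \<i>B\<close> has numerical range in the closed
  strip. Everything is expressed by the real quadratic form
  \<open>\<xi> \<mapsto> Im \<langle>T\<xi>|\<xi>\<rangle>\<close> of an operator \<open>T\<close>: symmetry means that it vanishes, and numerical
  range in the closed strip means that it is bounded by \<open>\<alpha>\<parallel>\<xi>\<parallel>\<^sup>2\<close>. The form of \<open>T'\<close> is
  the sum of the form of \<open>S'\<close> and of \<open>\<xi> \<mapsto> Re \<langle>B\<xi>|\<xi>\<rangle>\<close>.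

  The analytic point is \<open>quadratic_form_bound_closure\<close>: a real quadratic form bounded by
  some multiple of \<open>\<parallel>\<xi>\<parallel>\<^sup>2\<close> is continuous, so a better bound valid on a dense part of
  its domain holds on the whole domain. It is used twice. On \<open>D(S)\<close> the forms of \<open>\<i>B\<close> and
  \<open>T\<close> agree, so the form of \<open>\<i>B\<close>, which is bounded because \<open>B\<close> is, is bounded by
  \<open>\<alpha>\<parallel>\<xi>\<parallel>\<^sup>2\<close> on the dense subspace \<open>D(S)\<close> and hence everywhere; this settles one
  direction. Conversely, if \<open>T'\<close> has numerical range in the closed strip, then the form of
  \<open>S' = T' - \<i>B\<close> is bounded by \<open>2\<alpha>\<parallel>\<xi>\<parallel>\<^sup>2\<close>; as it vanishes on the dense subspace
  \<open>D(S)\<close>, it vanishes on \<open>D(S')\<close>. The operator \<open>S'\<close> itself may well be unbounded: only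
  the form of its skew part is controlled.
\<close>

section \<open>Bounded real quadratic forms\<close>

text \<open>
  A bound on the form \<open>q\<close> alone controls its polar form: evaluating
  \<open>\<beta> x e = q (x + e) - q x - q e\<close> at the normalised vector \<open>e / \<parallel>e\<parallel>\<close> gives a constant
  \<open>C\<close> depending on \<open>x\<close> with \<open>\<bar>\<beta> x e\<bar> \<le> C\<parallel>e\<parallel>\<close>.
  Hence \<open>q (x + e) \<longlonglongrightarrow> q x\<close> as \<open>e \<longlonglongrightarrow> 0\<close>, and the bound
  passes to the limit.
\<close>

lemma quadratic_form_bound_closure:
  fixes q :: "'a::real_normed_vector \<Rightarrow> real"
  assumes V: "subspace V"
    and polar: "\<And>x e. x \<in> V \<Longrightarrow> e \<in> V \<Longrightarrow> q (x + e) = q x + q e + \<beta> x e"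
    and scale: "\<And>x e t. x \<in> V \<Longrightarrow> e \<in> V \<Longrightarrow> \<beta> x (t *\<^sub>R e) = t * \<beta> x e"
    and bounded: "\<And>x. x \<in> V \<Longrightarrow> \<bar>q x\<bar> \<le> M * (norm x)\<^sup>2"
    and D: "D \<subseteq> V" "x \<in> closure D"
    and bound_D: "\<And>y. y \<in> D \<Longrightarrow> \<bar>q y\<bar> \<le> c * (norm y)\<^sup>2"
    and x: "x \<in> V"
  shows "\<bar>q x\<bar> \<le> c * (norm x)\<^sup>2"
proof -
  \<comment> \<open>If \<open>V = {0}\<close>, then \<open>M\<close> may be negative, which would spoil the monotonicity below.\<close>
  define M' where "M' = \<bar>M\<bar>"
  have bounded': "\<bar>q y\<bar> \<le> M' * (norm y)\<^sup>2" if "y \<in> V" for y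
    using bounded[OF that] mult_right_mono[of M "\<bar>M\<bar>" "(norm y)\<^sup>2"] unfolding M'_def
    by (meson abs_ge_self order_trans zero_le_power2)
  have M': "M' \<ge> 0" by (simp add: M'_def)
  define C where "C = M' * (norm x + 1)\<^sup>2 + M' * (norm x)\<^sup>2 + M'"
  have polar_bound: "\<bar>\<beta> x e\<bar> \<le> C * norm e" if e: "e \<in> V" for e
  proof (cases "e = 0")
    case True
    then show ?thesis using scale[OF x e, of 0] by simp
  next
    case False
    define u where "u = (1 / norm e) *\<^sub>R e"
    have u: "u \<in> V" "norm u = 1" "x + u \<in> V"
      using False e x V by (auto simp: u_def subspace_scale subspace_add)
    have "norm (x + u) \<le> norm x + 1"
      using norm_triangle_ineq[of x u] u by simp
    then have "M' * (norm (x + u))\<^sup>2 \<le> M' * (norm x + 1)\<^sup>2"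
      using M' by (intro mult_left_mono power_mono) auto
    then have "\<bar>\<beta> x u\<bar> \<le> C"
      using polar[OF x u(1)] bounded'[OF x] bounded'[OF u(1)] bounded'[OF u(3)] u(2)
      by (simp add: C_def)
    moreover have "\<beta> x u = \<beta> x e / norm e"
      using scale[OF x e, of "1 / norm e"] by (simp add: u_def)
    ultimately show ?thesis using False by (simp add: abs_divide pos_divide_le_eq)
  qed
  obtain y where y: "\<And>n. y n \<in> D" "y \<longlonglongrightarrow> x"
    using D(2) by (auto simp: closure_sequential)
  have diff: "norm (q (y n) - q x) \<le> C * norm (y n - x) + M' * (norm (y n - x))\<^sup>2" for n
  proof -
    have "y n - x \<in> V" using y D x V by (auto intro: subspace_diff)
    then show ?thesis
      using polar[OF x, of "y n - x"] polar_bound[of "y n - x"] bounded'[of "y n - x"] by simp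
  qed
  have "(\<lambda>n. C * norm (y n - x) + M' * (norm (y n - x))\<^sup>2) \<longlonglongrightarrow> C * norm (x - x) + M' * (norm (x - x))\<^sup>2"
    by (intro tendsto_intros y)
  then have "(\<lambda>n. C * norm (y n - x) + M' * (norm (y n - x))\<^sup>2) \<longlonglongrightarrow> 0"
    by simp
  then have "(\<lambda>n. q (y n) - q x) \<longlonglongrightarrow> 0"
    by (rule Lim_null_comparison[OF always_eventually[rule_format, OF diff]])
  then have "(\<lambda>n. q (y n)) \<longlonglongrightarrow> q x"
    by (simp add: LIM_zero_iff)
  then have "(\<lambda>n. \<bar>q (y n)\<bar>) \<longlonglongrightarrow> \<bar>q x\<bar>"
    by (rule tendsto_rabs)
  moreover have "(\<lambda>n. c * (norm (y n))\<^sup>2) \<longlonglongrightarrow> c * (norm x)\<^sup>2"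
    by (intro tendsto_intros y)
  ultimately show ?thesis
    by (rule LIMSEQ_le) (use bound_D y(1) in auto)
qed

section \<open>Complex inner products\<close>

lemma csubspace_imp_subspace:
  fixes V :: "'a::complex_vector set"
  assumes "csubspace V"
  shows "subspace V"
  using assms scaleC_of_real[where ?'a='a]
  unfolding complex_vector.subspace_def subspace_def by metis

lemma cinner_add_right:
  fixes x :: "'a::complex_inner"
  shows "cinner x (y + z) = cinner x y + cinner x z"
  by (metis cinner_add_left cinner_commute complex_cnj_add)

lemma cinner_scaleC_right:
  fixes x :: "'a::complex_inner"
  shows "cinner x (a *\<^sub>C y) = cnj a * cinner x y"
  by (metis cinner_scaleC_left cinner_commute complex_cnj_mult)

lemma cinner_scaleR_left:
  fixes x :: "'a::complex_inner"
  shows "cinner (r *\<^sub>R x) y = complex_of_real r * cinner x y"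
  by (metis cinner_scaleC_left scaleC_of_real)

lemma cinner_scaleR_right:
  fixes x :: "'a::complex_inner"
  shows "cinner x (r *\<^sub>R y) = complex_of_real r * cinner x y"
  by (metis cinner_scaleC_right complex_cnj_complex_of_real scaleC_of_real)

lemma norm_power2_eq_cinner:
  fixes x :: "'a::complex_inner"
  shows "(norm x)\<^sup>2 = Re (cinner x x)"
  by (simp add: norm_eq_sqrt_cinner cinner_ge_zero)

text \<open>
  Because the norm satisfies the triangle inequality, the real Cauchy-Schwarz inequality is
  just that inequality for \<open>x + y\<close> and \<open>y - x\<close>, squared and expanded.
\<close>

lemma abs_Re_cinner_le:
  fixes x y :: "'a::complex_inner"
  shows "\<bar>Re (cinner x y)\<bar> \<le> norm x * norm y"
proof -
  have upper: "Re (cinner u v) \<le> norm u * norm v" for u v :: 'a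
  proof -
    have "Re (cinner v u) = Re (cinner u v)"
      by (subst cinner_commute) simp
    then have "(norm (u + v))\<^sup>2 = (norm u)\<^sup>2 + (norm v)\<^sup>2 + 2 * Re (cinner u v)"
      by (simp add: norm_power2_eq_cinner cinner_add_left cinner_add_right)
    moreover have "(norm (u + v))\<^sup>2 \<le> (norm u + norm v)\<^sup>2"
      by (intro power_mono norm_triangle_ineq) auto
    ultimately show ?thesis by (simp add: power2_sum)
  qed
  have "cinner (- x) y = - cinner x y"
    using cinner_scaleR_left[of "-1" x y] by simp
  then show ?thesis using upper[of x y] upper[of "- x" y] by simp
qed

section \<open>The imaginary part of the numerical range\<close>

definition im_form :: "('a::chilbert_space \<rightharpoonup> 'a) \<Rightarrow> 'a \<Rightarrow> real"
  where "im_form T x = Im (cinner (the (T x)) x)"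

lemma operator_scaleR:
  assumes "operator T" "x \<in> dom T"
  shows "the (T (r *\<^sub>R x)) = r *\<^sub>R the (T x)"
  using assms unfolding operator_def by (metis scaleC_of_real)

lemma im_form_scaleR:
  assumes "operator T" "x \<in> dom T"
  shows "im_form T (r *\<^sub>R x) = r\<^sup>2 * im_form T x"
  using operator_scaleR[OF assms]
  by (simp add: im_form_def cinner_scaleR_left cinner_scaleR_right power2_eq_square)

text \<open>
  The form is homogeneous of degree 2, so that its values on unit vectors determine it. Stated with
  \<open>\<parallel>x\<parallel>\<^sup>2\<close>, the bound passes to limits without renormalising the approximating vectors.
\<close>

lemma numerical_range_subset_closed_strip_iff:
  assumes T: "operator T"
  shows "numerical_range T \<subseteq> closed_strip c \<longleftrightarrow> (\<forall>x\<in>dom T. \<bar>im_form T x\<bar> \<le> c * (norm x)\<^sup>2)"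
proof
  assume strip: "numerical_range T \<subseteq> closed_strip c"
  show "\<forall>x\<in>dom T. \<bar>im_form T x\<bar> \<le> c * (norm x)\<^sup>2"
  proof
    fix x assume x: "x \<in> dom T"
    show "\<bar>im_form T x\<bar> \<le> c * (norm x)\<^sup>2"
    proof (cases "x = 0")
      case True
      then show ?thesis using im_form_scaleR[OF T x, of 0] by simp
    next
      case False
      define u where "u = (1 / norm x) *\<^sub>R x"
      have "subspace (dom T)"
        using T by (simp add: operator_def csubspace_imp_subspace)
      then have u: "u \<in> dom T" "norm u = 1" and xu: "x = norm x *\<^sub>R u"
        using False x by (simp_all add: u_def subspace_scale)
      have "\<bar>im_form T u\<bar> \<le> c"
        using strip u by (auto simp: numerical_range_def closed_strip_def im_form_def)
      then have "(norm x)\<^sup>2 * \<bar>im_form T u\<bar> \<le> (norm x)\<^sup>2 * c"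
        by (intro mult_left_mono) auto
      moreover have "im_form T x = (norm x)\<^sup>2 * im_form T u"
        using im_form_scaleR[OF T u(1), of "norm x"] xu by simp
      ultimately show ?thesis by (simp add: abs_mult mult.commute)
    qed
  qed
next
  assume "\<forall>x\<in>dom T. \<bar>im_form T x\<bar> \<le> c * (norm x)\<^sup>2"
  then have "\<bar>Im (cinner (the (T x)) x)\<bar> \<le> c" if "x \<in> dom T" "norm x = 1" for x
    using that by (metis im_form_def mult_1_right power_one)
  then show "numerical_range T \<subseteq> closed_strip c"
    by (auto simp: numerical_range_def closed_strip_def simp del: domIff)
qed

text \<open>The real line is the closed strip of width \<open>0\<close>.\<close>

lemma symmetric_operator_iff_im_form_zero:
  "symmetric_operator T \<longleftrightarrow> operator T \<and> densely_defined T \<and> (\<forall>x\<in>dom T. im_form T x = 0)"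
proof -
  have "\<real> = closed_strip 0"
    by (auto simp: closed_strip_def complex_is_Real_iff)
  then show ?thesis
    using numerical_range_subset_closed_strip_iff[of T 0] by (auto simp: symmetric_operator_def)
qed

text \<open>
  The polar form of \<open>im_form T\<close> is
  \<open>\<beta> x e = Im (\<langle>Tx|e\<rangle> + \<langle>Te|x\<rangle>)\<close>. Some bound \<open>M\<close> on the whole domain has to be
  known beforehand; without it, a form may vanish on a dense subspace without vanishing.
\<close>

lemma im_form_bound_closure:
  assumes T: "operator T"
    and bounded: "\<And>x. x \<in> dom T \<Longrightarrow> \<bar>im_form T x\<bar> \<le> M * (norm x)\<^sup>2"
    and D: "D \<subseteq> dom T" "closure D = UNIV"
    and bound_D: "\<And>y. y \<in> D \<Longrightarrow> \<bar>im_form T y\<bar> \<le> c * (norm y)\<^sup>2"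
    and x: "x \<in> dom T"
  shows "\<bar>im_form T x\<bar> \<le> c * (norm x)\<^sup>2"
proof (rule quadratic_form_bound_closure[where V = "dom T" and D = D])
  let ?\<beta> = "\<lambda>x e. Im (cinner (the (T x)) e + cinner (the (T e)) x)"
  show "im_form T (x + e) = im_form T x + im_form T e + ?\<beta> x e"
    if "x \<in> dom T" "e \<in> dom T" for x e
  proof -
    have "the (T (x + e)) = the (T x) + the (T e)"
      using T that by (simp add: operator_def)
    then show ?thesis by (simp add: im_form_def cinner_add_left cinner_add_right)
  qed
  show "?\<beta> x (t *\<^sub>R e) = t * ?\<beta> x e" if "x \<in> dom T" "e \<in> dom T" for x e t
    using operator_scaleR[OF T that(2)]
    by (simp add: cinner_scaleR_left cinner_scaleR_right algebra_simps)
  show "subspace (dom T)"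
    using T by (simp add: operator_def csubspace_imp_subspace)
qed (use assms in auto)

section \<open>Sums and multiples of operators\<close>

lemma dom_op_add [simp]: "dom (S +\<^sub>o T) = dom S \<inter> dom T"
  by (auto simp: op_add_def split: if_splits)

lemma dom_op_scale [simp]: "dom (c *\<^sub>o T) = dom T"
  by (auto simp: op_scale_def)

lemma the_op_add: "x \<in> dom S \<Longrightarrow> x \<in> dom T \<Longrightarrow> the ((S +\<^sub>o T) x) = the (S x) + the (T x)"
  by (simp add: op_add_def)

lemma the_op_scale: "x \<in> dom T \<Longrightarrow> the ((c *\<^sub>o T) x) = c *\<^sub>C the (T x)"
  by (auto simp: op_scale_def)

lemma operator_op_add:
  assumes "operator S" "operator T"
  shows "operator (S +\<^sub>o T)"
proof -
  have sub: "csubspace (dom S)" "csubspace (dom T)"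
    using assms by (auto simp: operator_def)
  show ?thesis
    unfolding operator_def dom_op_add
  proof (intro conjI ballI allI)
    show "csubspace (dom S \<inter> dom T)"
      using sub by (rule complex_vector.subspace_inter)
    show "the ((S +\<^sub>o T) (x + y)) = the ((S +\<^sub>o T) x) + the ((S +\<^sub>o T) y)"
      if "x \<in> dom S \<inter> dom T" "y \<in> dom S \<inter> dom T" for x y
    proof -
      have "x + y \<in> dom S"
        using that by (intro complex_vector.subspace_add sub) simp_all
      moreover have "x + y \<in> dom T"
        using that by (intro complex_vector.subspace_add sub) simp_all
      moreover have "the (S (x + y)) = the (S x) + the (S y)" "the (T (x + y)) = the (T x) + the (T y)"
        using assms that unfolding operator_def by blast+
      ultimately show ?thesis using that by (simp add: the_op_add del: domIff)
    qed
    show "the ((S +\<^sub>o T) (c *\<^sub>C x)) = c *\<^sub>C the ((S +\<^sub>o T) x)"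
      if "x \<in> dom S \<inter> dom T" for c x
    proof -
      have "c *\<^sub>C x \<in> dom S"
        using that by (intro complex_vector.subspace_scale sub) simp_all
      moreover have "c *\<^sub>C x \<in> dom T"
        using that by (intro complex_vector.subspace_scale sub) simp_all
      moreover have "the (S (c *\<^sub>C x)) = c *\<^sub>C the (S x)" "the (T (c *\<^sub>C x)) = c *\<^sub>C the (T x)"
        using assms that unfolding operator_def by blast+
      ultimately show ?thesis
        using that by (simp add: the_op_add scaleC_add_right del: domIff)
    qed
  qed
qed

lemma operator_op_scale:
  assumes "operator T"
  shows "operator (c *\<^sub>o T)"
proof -
  have sub: "csubspace (dom T)"
    using assms by (auto simp: operator_def)
  show ?thesis
    unfolding operator_def dom_op_scale
  proof (intro conjI ballI allI)
    show "csubspace (dom T)" by (rule sub)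
    show "the ((c *\<^sub>o T) (x + y)) = the ((c *\<^sub>o T) x) + the ((c *\<^sub>o T) y)"
      if "x \<in> dom T" "y \<in> dom T" for x y
    proof -
      have "x + y \<in> dom T"
        using that by (intro complex_vector.subspace_add sub)
      moreover have "the (T (x + y)) = the (T x) + the (T y)"
        using assms that unfolding operator_def by blast
      ultimately show ?thesis
        using that by (simp add: the_op_scale scaleC_add_right del: domIff)
    qed
    show "the ((c *\<^sub>o T) (d *\<^sub>C x)) = d *\<^sub>C the ((c *\<^sub>o T) x)"
      if "x \<in> dom T" for d x
    proof -
      have "d *\<^sub>C x \<in> dom T"
        using that by (intro complex_vector.subspace_scale sub)
      moreover have "the (T (d *\<^sub>C x)) = d *\<^sub>C the (T x)"
        using assms that unfolding operator_def by blast
      ultimately show ?thesis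
        using that by (simp add: the_op_scale scaleC_scaleC mult.commute del: domIff)
    qed
  qed
qed

lemma op_add_map_le_mono: "S \<subseteq>\<^sub>m S' \<Longrightarrow> S +\<^sub>o T \<subseteq>\<^sub>m S' +\<^sub>o T"
  by (auto simp: map_le_def op_add_def dom_def)

text \<open>
  Totality of \<open>B\<close> is what makes this an equality of operators: in general
  \<open>(S + cB) - cB\<close> is the restriction of \<open>S\<close> to \<open>D(S) \<inter> D(B)\<close>.
\<close>

lemma op_add_scale_cancel:
  assumes "dom B = UNIV"
  shows "(S +\<^sub>o c *\<^sub>o B) +\<^sub>o (- c) *\<^sub>o B = S"
proof
  fix x
  have B: "x \<in> dom B" using assms by simp
  show "((S +\<^sub>o c *\<^sub>o B) +\<^sub>o (- c) *\<^sub>o B) x = S x"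
  proof (cases "x \<in> dom S")
    case True
    then have "the (((S +\<^sub>o c *\<^sub>o B) +\<^sub>o (- c) *\<^sub>o B) x) = the (S x)"
      using B by (simp add: the_op_add the_op_scale complex_vector.scale_minus_left del: domIff)
    moreover have "x \<in> dom ((S +\<^sub>o c *\<^sub>o B) +\<^sub>o (- c) *\<^sub>o B)"
      using True B by (simp del: domIff)
    ultimately show ?thesis
      using True by (metis domIff option.expand)
  next
    case False
    then have "x \<notin> dom ((S +\<^sub>o c *\<^sub>o B) +\<^sub>o (- c) *\<^sub>o B)"
      by (simp del: domIff)
    then show ?thesis using False by (metis domIff)
  qed
qed

lemma op_add_scale_in_extensions:
  assumes "operator B" "S' \<in> extensions S"
  shows "S' +\<^sub>o c *\<^sub>o B \<in> extensions (S +\<^sub>o c *\<^sub>o B)"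
  using assms by (auto simp: extensions_def intro: operator_op_add operator_op_scale op_add_map_le_mono)

lemma bij_betw_extensions_op_add_scale:
  assumes B: "operator B" "dom B = UNIV"
  shows "bij_betw (\<lambda>S'. S' +\<^sub>o c *\<^sub>o B) (extensions S) (extensions (S +\<^sub>o c *\<^sub>o B))"
proof (rule bij_betwI[where g = "\<lambda>T'. T' +\<^sub>o (- c) *\<^sub>o B"])
  show "(\<lambda>S'. S' +\<^sub>o c *\<^sub>o B) \<in> extensions S \<rightarrow> extensions (S +\<^sub>o c *\<^sub>o B)"
    using B by (auto intro: op_add_scale_in_extensions)
  show "(\<lambda>T'. T' +\<^sub>o (- c) *\<^sub>o B) \<in> extensions (S +\<^sub>o c *\<^sub>o B) \<rightarrow> extensions S"
    using op_add_scale_in_extensions[OF B(1), of _ "S +\<^sub>o c *\<^sub>o B" "- c"] op_add_scale_cancel[OF B(2)]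
    by auto
  show "(S' +\<^sub>o c *\<^sub>o B) +\<^sub>o (- c) *\<^sub>o B = S'" for S'
    by (rule op_add_scale_cancel[OF B(2)])
  show "(T' +\<^sub>o (- c) *\<^sub>o B) +\<^sub>o c *\<^sub>o B = T'" for T'
    using op_add_scale_cancel[OF B(2), of T' "- c"] by simp
qed

lemma im_form_op_add:
  assumes "x \<in> dom S" "x \<in> dom T"
  shows "im_form (S +\<^sub>o T) x = im_form S x + im_form T x"
  using assms by (simp add: im_form_def the_op_add cinner_add_left)

section \<open>The correspondence of extensions\<close>

lemma bounded_operator_im_form_bound:
  assumes "bounded_operator B"
  shows "\<exists>M. \<forall>x. \<bar>im_form (\<i> *\<^sub>o B) x\<bar> \<le> M * (norm x)\<^sup>2"
proof -
  obtain K where K: "\<And>x. norm (the (B x)) \<le> K * norm x"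
    using assms by (auto simp: bounded_operator_def)
  have "\<bar>im_form (\<i> *\<^sub>o B) x\<bar> \<le> K * (norm x)\<^sup>2" for x
  proof -
    have "x \<in> dom B" using assms by (simp add: bounded_operator_def)
    then have "im_form (\<i> *\<^sub>o B) x = Re (cinner (the (B x)) x)"
      by (simp add: im_form_def the_op_scale cinner_scaleC_left)
    also have "\<bar>\<dots>\<bar> \<le> norm (the (B x)) * norm x"
      by (rule abs_Re_cinner_le)
    also have "\<dots> \<le> K * norm x * norm x"
      by (intro mult_right_mono K) auto
    finally show ?thesis by (simp add: power2_eq_square mult.assoc)
  qed
  then show ?thesis by blast
qed

theorem lemma5p3:
  fixes T S B :: "'a::chilbert_space \<rightharpoonup> 'a"
    and \<alpha> :: real
    and A :: "complex set"
  assumes "horizontal_strip \<alpha> A"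
    and "operator T"
    and "densely_defined T"
    and "numerical_range T \<subseteq> A"
    and "symmetric_operator S"
    and "symmetric_operator B"
    and "bounded_operator B"
    and "dom S = dom T"
    and "T = S +\<^sub>o \<i> *\<^sub>o B"
  shows "bij_betw (\<lambda>S'. S' +\<^sub>o \<i> *\<^sub>o B) (extensions S) (extensions T) \<and>
         bij_betw (\<lambda>S'. S' +\<^sub>o \<i> *\<^sub>o B)
           {S' \<in> extensions S. symmetric_operator S'}
           {T' \<in> extensions T. numerical_range T' \<subseteq> closed_strip \<alpha>}"
proof -
  let ?C = "\<i> *\<^sub>o B"
  have S: "operator S" "closure (dom S) = UNIV" "\<And>x. x \<in> dom S \<Longrightarrow> im_form S x = 0"
    using assms(5) by (auto simp: symmetric_operator_iff_im_form_zero densely_defined_def)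
  have B: "operator B" "dom B = UNIV"
    using assms(7) by (auto simp: bounded_operator_def)
  have C: "operator ?C" "dom ?C = UNIV"
    using B by (simp_all add: operator_op_scale)
  have bij: "bij_betw (\<lambda>S'. S' +\<^sub>o ?C) (extensions S) (extensions T)"
    using bij_betw_extensions_op_add_scale[OF B] assms(9) by simp
  have C_bound: "\<bar>im_form ?C x\<bar> \<le> \<alpha> * (norm x)\<^sup>2" for x
  proof -
    obtain M where M: "\<And>x. \<bar>im_form ?C x\<bar> \<le> M * (norm x)\<^sup>2"
      using bounded_operator_im_form_bound[OF assms(7)] by blast
    have "numerical_range T \<subseteq> closed_strip \<alpha>"
      using assms(1,4) by (auto simp: horizontal_strip_def)
    then have T_bound: "\<bar>im_form T y\<bar> \<le> \<alpha> * (norm y)\<^sup>2" if "y \<in> dom S" for y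
      using numerical_range_subset_closed_strip_iff[OF assms(2)] assms(8) that by blast
    have "\<bar>im_form ?C y\<bar> \<le> \<alpha> * (norm y)\<^sup>2" if y: "y \<in> dom S" for y
      using T_bound[OF y] im_form_op_add[OF y, of ?C] S(3)[OF y] C(2) assms(9) by simp
    from im_form_bound_closure[OF C(1) M _ S(2) this] show ?thesis
      using C(2) by simp
  qed
  have "numerical_range (S' +\<^sub>o ?C) \<subseteq> closed_strip \<alpha> \<longleftrightarrow> symmetric_operator S'"
    if ext: "S' \<in> extensions S" for S'
  proof -
    have S': "operator S'" "S \<subseteq>\<^sub>m S'"
      using ext by (auto simp: extensions_def)
    have dom_le: "dom S \<subseteq> dom S'"
      using S'(2) by (rule map_le_implies_dom_le)
    have dense: "densely_defined S'"
      using closure_mono[OF dom_le] S(2) by (auto simp: densely_defined_def)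
    have sum: "im_form (S' +\<^sub>o ?C) x = im_form S' x + im_form ?C x" if "x \<in> dom S'" for x
      using im_form_op_add[OF that] C(2) by simp
    have strip_iff: "numerical_range (S' +\<^sub>o ?C) \<subseteq> closed_strip \<alpha> \<longleftrightarrow>
        (\<forall>x\<in>dom S'. \<bar>im_form S' x + im_form ?C x\<bar> \<le> \<alpha> * (norm x)\<^sup>2)"
      using numerical_range_subset_closed_strip_iff[OF operator_op_add[OF S'(1) C(1)]] C(2) sum
      by simp
    show ?thesis
    proof
      assume "symmetric_operator S'"
      then show "numerical_range (S' +\<^sub>o ?C) \<subseteq> closed_strip \<alpha>"
        using C_bound by (simp add: strip_iff symmetric_operator_iff_im_form_zero)
    next
      assume "numerical_range (S' +\<^sub>o ?C) \<subseteq> closed_strip \<alpha>"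
      then have "\<bar>im_form S' x + im_form ?C x\<bar> \<le> \<alpha> * (norm x)\<^sup>2" if "x \<in> dom S'" for x
        using that strip_iff by blast
      then have bounded: "\<bar>im_form S' x\<bar> \<le> (2 * \<alpha>) * (norm x)\<^sup>2" if "x \<in> dom S'" for x
        using C_bound[of x] that by fastforce
      have zero: "\<bar>im_form S' y\<bar> \<le> 0 * (norm y)\<^sup>2" if "y \<in> dom S" for y
        using S(3)[OF that] S'(2) that by (simp add: map_le_def im_form_def)
      \<comment> \<open>The bound \<open>0\<close> passes from \<open>D(S)\<close> to its closure.\<close>
      have "im_form S' x = 0" if "x \<in> dom S'" for x
        using im_form_bound_closure[OF S'(1) bounded dom_le S(2) zero that] by simp
      then show "symmetric_operator S'"
        using S'(1) dense by (simp add: symmetric_operator_iff_im_form_zero)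
    qed
  qed
  with bij show ?thesis
    by (simp add: bij_betw_Collect)
qed

end
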